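(* For a random real matrix $\mathbf{Z}$ write \[ F(\mathbf{Z})=\mathbb{E}\|\mathbf{Z}\|_{\mathrm{F}},\qquad W(\mathbf{Z})=\inf_{\mathbf{D}}\mathbb{E}\|\mathbf{Z}\mathbf{D}^{-1}\|_{2\to\infty}, \] where the infimum is over diagonal matrices $\mathbf{D}$ (of size the number of columns of $\mathbf{Z}$) with strictly positive diagonal entries and $\mathrm{trace}(\mathbf{D}^2)=1$. Each of the two terms in the bound $\mathbb{E}\|\mathbf{Z}\|_{\infty\to2}\le 2F(\mathbf{Z})+2W(\mathbf{Z})$ (for random $\mathbf{Z}$ with independent, zero-mean entries) is necessary, in the following sense. There exist a sequence of random matrices $\mathbf{Z}_N$ with independent, zero-mean entries and absolute constants $0<c\le C$ such that for all $N\geq 1$ \[ c\,F(\mathbf{Z}_N)\le\mathbb{E}\|\mathbf{Z}_N\|_{\infty\to2}\le C\,F(\mathbf{Z}_N)\quad\text{and}\quad \frac{\mathbb{E}\|\mathbf{Z}_N\|_{\infty\to2}}{W(\mathbf{Z}_N)}\to\infty\text{ as }N\to\infty; \] and there likewise exists such a sequence for which the same holds with the roles of $F$ and $W$ exchanged.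
   Context: For a real matrix $\mathbf{A}$: $\|\mathbf{A}\|_{\infty\to2}=\max_{\mathbf{u}\ne\mathbf{0}}\|\mathbf{A}\mathbf{u}\|_2/\|\mathbf{u}\|_\infty$; $\|\mathbf{A}\|_{\mathrm{F}}$ is the Frobenius norm; $\|\mathbf{A}\|_{2\to\infty}=\max_{\mathbf{u}\ne\mathbf{0}}\|\mathbf{A}\mathbf{u}\|_\infty/\|\mathbf{u}\|_2$, which equals the largest $\ell_2$ norm of a row of $\mathbf{A}$. *)

theory Defs
  imports "HOL-Probability.Probability" "Jordan_Normal_Form.Matrix"
begin

unbundle no vec_syntax

definition vec_l2 :: "real vec \<Rightarrow> real" where
  "vec_l2 v = L2_set (\<lambda>i. v $ i) {..<dim_vec v}"

definition vec_linf :: "real vec \<Rightarrow> real" where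
  "vec_linf v = Max ((\<lambda>i. \<bar>v $ i\<bar>) ` {..<dim_vec v})"

definition norm_F :: "real mat \<Rightarrow> real" where
  "norm_F A = sqrt (\<Sum>i<dim_row A. \<Sum>j<dim_col A. (A $$ (i, j))\<^sup>2)"

(* The maxima over nonzero vectors are rendered as suprema. For matrices with at
   least one row and one column (the only ones used) these are suprema of nonempty
   bounded sets, and they are attained. *)
definition norm_inf_2 :: "real mat \<Rightarrow> real" where
  "norm_inf_2 A =
     (SUP u \<in> carrier_vec (dim_col A) - {0\<^sub>v (dim_col A)}. vec_l2 (A *\<^sub>v u) / vec_linf u)"

definition norm_2_inf :: "real mat \<Rightarrow> real" where
  "norm_2_inf A =
     (SUP u \<in> carrier_vec (dim_col A) - {0\<^sub>v (dim_col A)}. vec_linf (A *\<^sub>v u) / vec_l2 u)"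

definition mat_trace :: "real mat \<Rightarrow> real" where
  "mat_trace A = (\<Sum>i<dim_row A. A $$ (i, i))"

definition weight_mat :: "nat \<Rightarrow> real mat \<Rightarrow> bool" where
  "weight_mat n D \<longleftrightarrow> D \<in> carrier_mat n n \<and> diagonal_mat D \<and>
     (\<forall>i<n. 0 < D $$ (i, i)) \<and> mat_trace (D ^\<^sub>m 2) = 1"

(* Integrability of the entries makes all the norms below integrable, so that their
   Bochner integrals are genuine expectations. *)
definition indep_centered_mat ::
    "'w measure \<Rightarrow> nat \<Rightarrow> nat \<Rightarrow> ('w \<Rightarrow> real mat) \<Rightarrow> bool" where
  "indep_centered_mat M m n Z \<longleftrightarrow>
     (\<forall>\<omega>\<in>space M. Z \<omega> \<in> carrier_mat m n) \<and>
     prob_space.indep_vars M (\<lambda>_. borel) (\<lambda>ij \<omega>. Z \<omega> $$ ij) ({..<m} \<times> {..<n}) \<and>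
     (\<forall>i<m. \<forall>j<n. integrable M (\<lambda>\<omega>. Z \<omega> $$ (i, j)) \<and>
                   integral\<^sup>L M (\<lambda>\<omega>. Z \<omega> $$ (i, j)) = 0)"

definition E_inf_2 :: "'w measure \<Rightarrow> ('w \<Rightarrow> real mat) \<Rightarrow> real" where
  "E_inf_2 M Z = (\<integral>\<omega>. norm_inf_2 (Z \<omega>) \<partial>M)"

definition F_term :: "'w measure \<Rightarrow> ('w \<Rightarrow> real mat) \<Rightarrow> real" where
  "F_term M Z = (\<integral>\<omega>. norm_F (Z \<omega>) \<partial>M)"

(* n is the number of columns of Z, and B ranges over the inverses of the D. *)
definition W_term :: "'w measure \<Rightarrow> nat \<Rightarrow> ('w \<Rightarrow> real mat) \<Rightarrow> real" where
  "W_term M n Z =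
     Inf {(\<integral>\<omega>. norm_2_inf (Z \<omega> * B) \<partial>M) | D B.
            weight_mat n D \<and> B \<in> carrier_mat n n \<and> inverts_mat D B}"

end

theory Submission
  imports Defs
begin

text \<open>Sign matrices with a single column or a single row have deterministic norms. An N-by-1 sign
  matrix has F = E = sqrt N and W = 1; a 1-by-N sign matrix has W = E = N and F = sqrt N. For the
  row, W is the infimum of the l2-norm of (1/d_j) over unit vectors d, which by Cauchy-Schwarz is
  attained at the constant vector.\<close>

section \<open>Norms of matrices with a single row or a single column\<close>

lemma nonzero_vecE:
  fixes u :: "real vec"
  assumes "u \<in> carrier_vec n - {0\<^sub>v n}"
  obtains j where "j < n" "u $ j \<noteq> 0"
  using assms by (auto simp: vec_eq_iff)

lemma vec_linf_ge: "j < dim_vec u \<Longrightarrow> \<bar>u $ j\<bar> \<le> vec_linf u"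
  unfolding vec_linf_def by (rule Max_ge) auto

lemma vec_linf_pos:
  assumes "u \<in> carrier_vec n - {0\<^sub>v n}"
  shows "0 < vec_linf u"
proof -
  obtain j where "j < n" "u $ j \<noteq> 0" using assms by (rule nonzero_vecE)
  then show ?thesis using vec_linf_ge[of j u] assms by (auto intro: less_le_trans[OF zero_less_abs_iff[THEN iffD2]])
qed

lemma vec_l2_pos:
  assumes "u \<in> carrier_vec n - {0\<^sub>v n}"
  shows "0 < vec_l2 u"
proof -
  obtain j where "j < n" "u $ j \<noteq> 0" using assms by (rule nonzero_vecE)
  then show ?thesis unfolding vec_l2_def L2_set_def
    using assms by (auto intro!: sum_pos2[of _ j])
qed

lemma vec_l2_dim_1: "dim_vec v = 1 \<Longrightarrow> vec_l2 v = \<bar>v $ 0\<bar>"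
  by (simp add: vec_l2_def L2_set_def)

lemma vec_linf_dim_1: "dim_vec v = 1 \<Longrightarrow> vec_linf v = \<bar>v $ 0\<bar>"
  by (simp add: vec_linf_def lessThan_Suc)

lemma row_mult_vec:
  fixes A :: "real mat"
  assumes "A \<in> carrier_mat m n" "u \<in> carrier_vec n" "i < m"
  shows "(A *\<^sub>v u) $ i = (\<Sum>j<n. A $$ (i, j) * u $ j)"
  using assms by (auto simp: scalar_prod_def atLeast0LessThan intro!: sum.cong)

lemma ones_vec_nonzero: "vec 1 (\<lambda>_. 1) \<in> carrier_vec 1 - {0\<^sub>v 1 :: real vec}"
  by (auto simp: vec_eq_iff)

text \<open>With one output coordinate, the quotient is a linear functional measured against the sup
  norm, and the l1-norm is the dual of the sup norm. The maximum is attained at the sign pattern of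
  the row.\<close>

lemma norm_inf_2_row:
  assumes A: "A \<in> carrier_mat 1 n" and n: "1 \<le> n"
  shows "norm_inf_2 A = (\<Sum>j<n. \<bar>A $$ (0, j)\<bar>)"
  unfolding norm_inf_2_def
proof (rule cSup_eq_maximum)
  have l2: "vec_l2 (A *\<^sub>v u) = \<bar>\<Sum>j<n. A $$ (0, j) * u $ j\<bar>" if "u \<in> carrier_vec n" for u
    using vec_l2_dim_1[of "A *\<^sub>v u"] row_mult_vec[OF A that, of 0] A by simp
  \<comment> \<open>Assigning 1 rather than 0 to vanishing entries keeps every modulus equal to 1,
    so \<open>u\<close> is nonzero with \<open>vec_linf u = 1\<close> even when the row is
    zero.\<close>
  define u where "u = vec n (\<lambda>j. if 0 \<le> A $$ (0, j) then 1 else (-1::real))"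
  have u: "u \<in> carrier_vec n" by (simp add: u_def)
  have "u $ 0 \<noteq> 0\<^sub>v n $ 0" using n by (simp add: u_def)
  then have "u \<noteq> 0\<^sub>v n" by metis
  have "(\<lambda>j. \<bar>u $ j\<bar>) ` {..<n} = {1}"
    using n by (force simp: u_def image_iff Bex_def intro!: exI[of _ 0])
  then have "vec_linf u = 1" using u by (simp add: vec_linf_def)
  moreover have "(\<Sum>j<n. A $$ (0, j) * u $ j) = (\<Sum>j<n. \<bar>A $$ (0, j)\<bar>)"
    by (rule sum.cong) (auto simp: u_def)
  ultimately show "(\<Sum>j<n. \<bar>A $$ (0, j)\<bar>) \<in> (\<lambda>u. vec_l2 (A *\<^sub>v u) / vec_linf u) `
      (carrier_vec (dim_col A) - {0\<^sub>v (dim_col A)})"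
    using A u \<open>u \<noteq> 0\<^sub>v n\<close> by (intro image_eqI[of _ _ u]) (auto simp: l2 sum_nonneg)
  fix x assume "x \<in> (\<lambda>u. vec_l2 (A *\<^sub>v u) / vec_linf u) `
      (carrier_vec (dim_col A) - {0\<^sub>v (dim_col A)})"
  then obtain v where v: "v \<in> carrier_vec n - {0\<^sub>v n}" and x: "x = vec_l2 (A *\<^sub>v v) / vec_linf v"
    using A by auto
  have "\<bar>\<Sum>j<n. A $$ (0, j) * v $ j\<bar> \<le> (\<Sum>j<n. \<bar>A $$ (0, j)\<bar> * \<bar>v $ j\<bar>)"
    by (rule order_trans[OF sum_abs]) (simp add: abs_mult)
  also have "\<dots> \<le> (\<Sum>j<n. \<bar>A $$ (0, j)\<bar> * vec_linf v)"
    using v by (intro sum_mono mult_left_mono vec_linf_ge) auto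
  finally show "x \<le> (\<Sum>j<n. \<bar>A $$ (0, j)\<bar>)"
    using v vec_linf_pos[OF v] by (simp add: x l2 divide_le_eq sum_distrib_right)
qed

text \<open>The l2-norm is self-dual: Cauchy-Schwarz gives the upper bound and the row itself
  attains it. The nonzero entry makes the row an admissible vector for the supremum.\<close>

lemma norm_2_inf_row:
  assumes A: "A \<in> carrier_mat 1 n" and k: "k < n" "A $$ (0, k) \<noteq> 0"
  shows "norm_2_inf A = L2_set (\<lambda>j. A $$ (0, j)) {..<n}"
  unfolding norm_2_inf_def
proof (rule cSup_eq_maximum)
  have linf: "vec_linf (A *\<^sub>v u) = \<bar>\<Sum>j<n. A $$ (0, j) * u $ j\<bar>" if "u \<in> carrier_vec n" for u
    using vec_linf_dim_1[of "A *\<^sub>v u"] row_mult_vec[OF A that, of 0] A by simp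
  let ?L = "L2_set (\<lambda>j. A $$ (0, j)) {..<n}"
  \<comment> \<open>Equality case of Cauchy-Schwarz: the row paired with itself gives
    \<open>?L\<^sup>2\<close>, and dividing by \<open>vec_l2 u = ?L\<close> leaves
    \<open>?L\<close>.\<close>
  define u where "u = vec n (\<lambda>j. A $$ (0, j))"
  have u: "u \<in> carrier_vec n" by (simp add: u_def)
  have "u $ k \<noteq> 0\<^sub>v n $ k" using k by (simp add: u_def)
  then have u0: "u \<in> carrier_vec n - {0\<^sub>v n}" using u by auto
  have "vec_l2 u = ?L" by (auto simp: vec_l2_def u_def intro!: L2_set_cong)
  moreover have "(\<Sum>j<n. A $$ (0, j) * u $ j) = ?L\<^sup>2"
    by (auto simp: u_def L2_set_def sum_nonneg power2_eq_square intro!: sum.cong)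
  ultimately show "?L \<in> (\<lambda>u. vec_linf (A *\<^sub>v u) / vec_l2 u) `
      (carrier_vec (dim_col A) - {0\<^sub>v (dim_col A)})"
    using A u0 vec_l2_pos[OF u0]
    by (intro image_eqI[of _ _ u]) (auto simp: linf power2_eq_square)
  fix x assume "x \<in> (\<lambda>u. vec_linf (A *\<^sub>v u) / vec_l2 u) `
      (carrier_vec (dim_col A) - {0\<^sub>v (dim_col A)})"
  then obtain v where v: "v \<in> carrier_vec n - {0\<^sub>v n}" and x: "x = vec_linf (A *\<^sub>v v) / vec_l2 v"
    using A by auto
  have "\<bar>\<Sum>j<n. A $$ (0, j) * v $ j\<bar> \<le> (\<Sum>j<n. \<bar>A $$ (0, j)\<bar> * \<bar>v $ j\<bar>)"
    by (rule order_trans[OF sum_abs]) (simp add: abs_mult)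
  also have "\<dots> \<le> ?L * vec_l2 v"
    using v L2_set_mult_ineq[of "\<lambda>j. A $$ (0, j)" "\<lambda>j. v $ j" "{..<n}"]
    by (simp add: vec_l2_def carrier_vecD[of v n])
  finally show "x \<le> ?L"
    using v vec_l2_pos[OF v] by (simp add: x linf divide_le_eq)
qed

text \<open>In dimension one the vector is a scalar, which cancels from the quotient by homogeneity.
  The quotient is therefore constant, and the supremum only needs one nonzero vector as a
  witness.\<close>

lemma norm_inf_2_col:
  assumes A: "A \<in> carrier_mat m 1"
  shows "norm_inf_2 A = L2_set (\<lambda>i. A $$ (i, 0)) {..<m}"
  unfolding norm_inf_2_def
proof (rule cSup_eq_maximum)
  have q: "vec_l2 (A *\<^sub>v u) / vec_linf u = L2_set (\<lambda>i. A $$ (i, 0)) {..<m}"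
    if u: "u \<in> carrier_vec 1 - {0\<^sub>v 1}" for u
  proof -
    have "vec_l2 (A *\<^sub>v u) = L2_set (\<lambda>i. \<bar>u $ 0\<bar> * A $$ (i, 0)) {..<m}"
      using A u row_mult_vec[OF A, of u] by (simp add: vec_l2_def L2_set_def power_mult_distrib mult.commute)
    then show ?thesis
      using u vec_linf_pos[OF u] vec_linf_dim_1[of u] by (simp flip: L2_set_right_distrib)
  qed
  show "L2_set (\<lambda>i. A $$ (i, 0)) {..<m} \<in> (\<lambda>u. vec_l2 (A *\<^sub>v u) / vec_linf u) `
      (carrier_vec (dim_col A) - {0\<^sub>v (dim_col A)})"
    using A q[OF ones_vec_nonzero] ones_vec_nonzero
    by (intro image_eqI[of _ _ "vec 1 (\<lambda>_. 1)"]) simp_all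
  show "x \<le> L2_set (\<lambda>i. A $$ (i, 0)) {..<m}" if "x \<in> (\<lambda>u. vec_l2 (A *\<^sub>v u) / vec_linf u) `
      (carrier_vec (dim_col A) - {0\<^sub>v (dim_col A)})" for x
    using that q A by auto
qed

lemma norm_2_inf_sign_col:
  assumes A: "A \<in> carrier_mat m 1" and m: "1 \<le> m" and s: "\<And>i. i < m \<Longrightarrow> \<bar>A $$ (i, 0)\<bar> = 1"
  shows "norm_2_inf A = 1"
  unfolding norm_2_inf_def
proof (rule cSup_eq_maximum)
  have q: "vec_linf (A *\<^sub>v u) / vec_l2 u = 1"
    if u: "u \<in> carrier_vec 1 - {0\<^sub>v 1}" for u
  proof -
    \<comment> \<open>All output coordinates have the same modulus, so the maximum is taken over a
      singleton; \<open>1 \<le> m\<close> ensures that it is not empty.\<close>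
    have "(\<lambda>i. \<bar>(A *\<^sub>v u) $ i\<bar>) ` {..<m} = {\<bar>u $ 0\<bar>}"
      using A u m row_mult_vec[OF A, of u] s by (force simp: abs_mult image_iff)
    then have "vec_linf (A *\<^sub>v u) = \<bar>u $ 0\<bar>" using A by (simp add: vec_linf_def)
    then show ?thesis
      using u vec_l2_pos[OF u] vec_l2_dim_1[of u] by simp
  qed
  show "1 \<in> (\<lambda>u. vec_linf (A *\<^sub>v u) / vec_l2 u) `
      (carrier_vec (dim_col A) - {0\<^sub>v (dim_col A)})"
    using A q[OF ones_vec_nonzero] ones_vec_nonzero
    by (intro image_eqI[of _ _ "vec 1 (\<lambda>_. 1)"]) simp_all
  show "x \<le> 1" if "x \<in> (\<lambda>u. vec_linf (A *\<^sub>v u) / vec_l2 u) `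
      (carrier_vec (dim_col A) - {0\<^sub>v (dim_col A)})" for x
    using that q A by auto
qed

section \<open>Diagonal weights and their inverses\<close>

lemma diagonal_mat_mult_index:
  fixes D :: "real mat"
  assumes "D \<in> carrier_mat n n" "diagonal_mat D" "B \<in> carrier_mat n k" "i < n" "j < k"
  shows "(D * B) $$ (i, j) = D $$ (i, i) * B $$ (i, j)"
proof -
  have "(D * B) $$ (i, j) = (\<Sum>l<n. D $$ (i, l) * B $$ (l, j))"
    using assms by (auto simp: scalar_prod_def atLeast0LessThan intro!: sum.cong)
  also have "\<dots> = (\<Sum>l<n. if l = i then D $$ (i, i) * B $$ (i, j) else 0)"
    using assms by (intro sum.cong) (auto simp: diagonal_mat_def)
  finally show ?thesis using assms by simp
qed

text \<open>Squaring a diagonal matrix squares its diagonal, so the trace condition says that the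
  diagonal is a unit vector in l2. This is the form needed for Cauchy-Schwarz.\<close>

lemma weight_mat_iff:
  "weight_mat n D \<longleftrightarrow> D \<in> carrier_mat n n \<and> diagonal_mat D \<and>
     (\<forall>i<n. 0 < D $$ (i, i)) \<and> (\<Sum>i<n. (D $$ (i, i))\<^sup>2) = 1"
proof -
  have "mat_trace (D ^\<^sub>m 2) = (\<Sum>i<n. (D $$ (i, i))\<^sup>2)"
    if "D \<in> carrier_mat n n" "diagonal_mat D"
  proof -
    have "D ^\<^sub>m 2 = D * D" using that by (simp add: numeral_2_eq_2)
    then show ?thesis
      using that diagonal_mat_mult_index[OF that that(1)] unfolding mat_trace_def
      by (simp add: power2_eq_square del: index_mult_mat(1))
  qed
  then show ?thesis unfolding weight_mat_def by auto
qed

text \<open>Row i of \<open>D * B\<close> is row i of \<open>B\<close> scaled by the positive number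
  \<open>D $$ (i, i)\<close>, so the identity \<open>D * B = 1\<close> determines \<open>B\<close>.
  Hence each weight contributes exactly one value to the set in \<open>W_term\<close>.\<close>

lemma inverse_weight_mat_index:
  assumes D: "weight_mat n D" and B: "B \<in> carrier_mat n n" "inverts_mat D B" and ij: "i < n" "j < n"
  shows "B $$ (i, j) = (if i = j then 1 / D $$ (i, i) else 0)"
proof -
  have "D $$ (i, i) * B $$ (i, j) = (1\<^sub>m n) $$ (i, j)"
    using diagonal_mat_mult_index[of D n B n i j] assms
    by (auto simp: inverts_mat_def weight_mat_def simp del: index_mult_mat(1))
  moreover have "0 < D $$ (i, i)" using D ij by (simp add: weight_mat_def)
  ultimately show ?thesis using ij by (auto simp: field_simps split: if_splits)
qed

lemma mult_inverse_weight_mat_index: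
  assumes A: "A \<in> carrier_mat m n" and D: "weight_mat n D"
    and B: "B \<in> carrier_mat n n" "inverts_mat D B" and ij: "i < m" "j < n"
  shows "(A * B) $$ (i, j) = A $$ (i, j) / D $$ (j, j)"
proof -
  have "(A * B) $$ (i, j) = (\<Sum>l<n. A $$ (i, l) * B $$ (l, j))"
    using assms by (auto simp: scalar_prod_def atLeast0LessThan intro!: sum.cong)
  also have "\<dots> = (\<Sum>l<n. if l = j then A $$ (i, j) / D $$ (j, j) else 0)"
    using ij by (intro sum.cong) (auto simp: inverse_weight_mat_index[OF D B])
  finally show ?thesis using ij by simp
qed

text \<open>The optimal weight for a single row: the n squared diagonal entries are all equal, hence
  1/n each.\<close>

definition const_weight :: "nat \<Rightarrow> real mat" where
  "const_weight n = mat n n (\<lambda>(i, j). if i = j then 1 / sqrt n else 0)"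

definition const_weight_inv :: "nat \<Rightarrow> real mat" where
  "const_weight_inv n = mat n n (\<lambda>(i, j). if i = j then sqrt n else 0)"

lemma weight_mat_const_weight: "1 \<le> n \<Longrightarrow> weight_mat n (const_weight n)"
  by (auto simp: weight_mat_iff const_weight_def diagonal_mat_def power_divide)

lemma const_weight_inv_carrier: "const_weight_inv n \<in> carrier_mat n n"
  by (simp add: const_weight_inv_def)

lemma inverts_const_weight_inv:
  assumes "1 \<le> n"
  shows "inverts_mat (const_weight n) (const_weight_inv n)"
proof -
  have "const_weight n * const_weight_inv n = 1\<^sub>m n"
  proof (rule eq_matI)
    fix i j assume "i < dim_row (1\<^sub>m n :: real mat)" "j < dim_col (1\<^sub>m n :: real mat)"
    then show "(const_weight n * const_weight_inv n) $$ (i, j) = 1\<^sub>m n $$ (i, j)"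
      using diagonal_mat_mult_index[of "const_weight n" n "const_weight_inv n" n i j]
        weight_mat_const_weight[OF assms] const_weight_inv_carrier
      by (simp add: weight_mat_def const_weight_def const_weight_inv_def del: index_mult_mat(1))
  qed (simp_all add: const_weight_def const_weight_inv_def)
  then show ?thesis by (simp add: inverts_mat_def const_weight_def)
qed

section \<open>Exact values of the three expectations for sign matrices\<close>

locale sign_matrix = prob_space M for M :: "'w measure" +
  fixes Z :: "'w \<Rightarrow> real mat" and m n :: nat
  assumes carrier: "\<And>\<omega>. Z \<omega> \<in> carrier_mat m n"
    and sign: "\<And>\<omega> i j. i < m \<Longrightarrow> j < n \<Longrightarrow> \<bar>Z \<omega> $$ (i, j)\<bar> = 1"
    and dims: "1 \<le> m" "1 \<le> n"
begin

text \<open>Every squared entry is 1 at every sample point, so the integrand is a constant and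
  integrates to itself under a probability measure. The other expectations below, for one row or one
  column, are computed in the same way.\<close>

lemma F_term_eq: "F_term M Z = sqrt (m * n)"
proof -
  have "(Z \<omega> $$ (i, j))\<^sup>2 = 1" if "i < m" "j < n" for \<omega> i j
    using sign[OF that] by (simp add: abs_square_eq_1)
  then have "norm_F (Z \<omega>) = sqrt (m * n)" for \<omega>
    using carrier[of \<omega>] by (simp add: norm_F_def)
  then show ?thesis by (simp add: F_term_def prob_space)
qed

lemma E_inf_2_col:
  assumes "n = 1"
  shows "E_inf_2 M Z = sqrt m"
proof -
  have "norm_inf_2 (Z \<omega>) = sqrt m" for \<omega>
  proof -
    have "norm_inf_2 (Z \<omega>) = L2_set (\<lambda>i. Z \<omega> $$ (i, 0)) {..<m}"
      using norm_inf_2_col carrier assms by metis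
    also have "\<dots> = L2_set (\<lambda>_. 1) {..<m}"
      using sign assms by (auto simp: L2_set_def abs_square_eq_1 simp flip: abs_square_eq_1)
    finally show ?thesis by (simp add: L2_set_constant)
  qed
  then show ?thesis by (simp add: E_inf_2_def prob_space)
qed

lemma E_inf_2_row:
  assumes "m = 1"
  shows "E_inf_2 M Z = n"
proof -
  have "norm_inf_2 (Z \<omega>) = n" for \<omega>
    using norm_inf_2_row[of "Z \<omega>" n] carrier[of \<omega>] assms sign dims by simp
  then show ?thesis by (simp add: E_inf_2_def prob_space)
qed

text \<open>Provides an element of the set whose infimum is \<open>W_term\<close>; in both shapes it
  turns out to be the minimum.\<close>

lemma const_weight_inv_mem:
  "(\<integral>\<omega>. norm_2_inf (Z \<omega> * const_weight_inv n) \<partial>M) \<in> {(\<integral>\<omega>. norm_2_inf (Z \<omega> * B) \<partial>M) | D B.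
      weight_mat n D \<and> B \<in> carrier_mat n n \<and> inverts_mat D B}"
  using weight_mat_const_weight[OF dims(2)] const_weight_inv_carrier
    inverts_const_weight_inv[OF dims(2)]
  by (intro CollectI exI[of _ "const_weight n"] exI[of _ "const_weight_inv n"] conjI refl)

lemma W_term_col:
  assumes "n = 1"
  shows "W_term M n Z = 1"
proof -
  have eq: "(\<integral>\<omega>. norm_2_inf (Z \<omega> * B) \<partial>M) = 1"
    if D: "weight_mat n D" and B: "B \<in> carrier_mat n n" "inverts_mat D B" for D B
  proof -
    \<comment> \<open>With one column the trace condition leaves only 1 and -1 for this entry, and
      positivity excludes -1. The set defining \<open>W_term\<close> is thus a single point.\<close>
    have "D $$ (0, 0) = 1"
      using D assms by (auto simp: weight_mat_iff power2_eq_1_iff)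
    then have "norm_2_inf (Z \<omega> * B) = 1" for \<omega>
      using carrier[of \<omega>] B assms dims sign mult_inverse_weight_mat_index[OF carrier[of \<omega>] D B]
      by (intro norm_2_inf_sign_col[of _ m]) (auto simp del: index_mult_mat(1))
    then show ?thesis by (simp add: prob_space)
  qed
  show ?thesis unfolding W_term_def
  proof (rule cInf_eq_minimum)
    show "1 \<in> {(\<integral>\<omega>. norm_2_inf (Z \<omega> * B) \<partial>M) | D B.
        weight_mat n D \<and> B \<in> carrier_mat n n \<and> inverts_mat D B}"
      using const_weight_inv_mem weight_mat_const_weight[OF dims(2)] const_weight_inv_carrier
        inverts_const_weight_inv[OF dims(2)] by (simp only: eq)
  qed (use eq in auto)
qed

lemma W_term_row:
  assumes "m = 1"
  shows "W_term M n Z = n"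
proof -
  have eq: "(\<integral>\<omega>. norm_2_inf (Z \<omega> * B) \<partial>M) = L2_set (\<lambda>j. 1 / D $$ (j, j)) {..<n}"
    if D: "weight_mat n D" and B: "B \<in> carrier_mat n n" "inverts_mat D B" for D B
  proof -
    have Dp: "0 < D $$ (j, j)" if "j < n" for j using D that by (simp add: weight_mat_def)
    have "norm_2_inf (Z \<omega> * B) = L2_set (\<lambda>j. 1 / D $$ (j, j)) {..<n}" for \<omega>
    proof -
      note ent = mult_inverse_weight_mat_index[OF carrier[of \<omega>] D B, of 0]
      \<comment> \<open>A sign divided by a positive weight is nonzero, which supplies the nonzero
        entry required by \<open>norm_2_inf_row\<close>.\<close>
      have Z0: "(Z \<omega> * B) $$ (0, 0) \<noteq> 0"
        using ent[of 0] sign[of 0 0 \<omega>] Dp[of 0] dims by (auto simp del: index_mult_mat(1))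
      have "norm_2_inf (Z \<omega> * B) = L2_set (\<lambda>j. (Z \<omega> * B) $$ (0, j)) {..<n}"
        using carrier[of \<omega>] B assms dims Z0 by (intro norm_2_inf_row[of _ _ 0]) auto
      also have "\<dots> = L2_set (\<lambda>j. 1 / D $$ (j, j)) {..<n}"
        unfolding L2_set_def
      proof (intro arg_cong[where f = sqrt] sum.cong refl)
        fix j assume "j \<in> {..<n}"
        then have "(Z \<omega> $$ (0, j))\<^sup>2 = 1" using sign[of 0 j \<omega>] dims by (simp add: abs_square_eq_1)
        then show "((Z \<omega> * B) $$ (0, j))\<^sup>2 = (1 / D $$ (j, j))\<^sup>2"
          using ent[of j] \<open>j \<in> {..<n}\<close> dims by (simp add: power_divide del: index_mult_mat(1))
      qed
      finally show ?thesis .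
    qed
    then show ?thesis by (simp add: prob_space)
  qed
  show ?thesis unfolding W_term_def
  proof (rule cInf_eq_minimum)
    have "L2_set (\<lambda>j. 1 / const_weight n $$ (j, j)) {..<n} = L2_set (\<lambda>_. sqrt n) {..<n}"
      by (auto simp: const_weight_def intro!: L2_set_cong)
    then have "L2_set (\<lambda>j. 1 / const_weight n $$ (j, j)) {..<n} = n"
      by (simp add: L2_set_constant)
    then have "(\<integral>\<omega>. norm_2_inf (Z \<omega> * const_weight_inv n) \<partial>M) = n"
      using eq[OF weight_mat_const_weight const_weight_inv_carrier inverts_const_weight_inv] dims
      by simp
    then show "real n \<in> {(\<integral>\<omega>. norm_2_inf (Z \<omega> * B) \<partial>M) | D B.
        weight_mat n D \<and> B \<in> carrier_mat n n \<and> inverts_mat D B}"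
      using const_weight_inv_mem by simp
    fix x assume "x \<in> {(\<integral>\<omega>. norm_2_inf (Z \<omega> * B) \<partial>M) | D B.
        weight_mat n D \<and> B \<in> carrier_mat n n \<and> inverts_mat D B}"
    then obtain D where D: "weight_mat n D" and x: "x = L2_set (\<lambda>j. 1 / D $$ (j, j)) {..<n}"
      using eq by auto
    \<comment> \<open>The number n is the inner product of the reciprocal diagonal with the
      diagonal, and the latter has l2-norm 1, so Cauchy-Schwarz bounds n by
      \<open>x\<close>.\<close>
    have "\<bar>1 / D $$ (j, j)\<bar> * \<bar>D $$ (j, j)\<bar> = 1" if "j < n" for j
      using D that by (auto simp: weight_mat_def)
    then have "real n = (\<Sum>j<n. \<bar>1 / D $$ (j, j)\<bar> * \<bar>D $$ (j, j)\<bar>)"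
      by simp
    also have "\<dots> \<le> L2_set (\<lambda>j. 1 / D $$ (j, j)) {..<n} * L2_set (\<lambda>j. D $$ (j, j)) {..<n}"
      by (rule L2_set_mult_ineq)
    also have "L2_set (\<lambda>j. D $$ (j, j)) {..<n} = 1"
      using D by (simp add: weight_mat_iff L2_set_def)
    finally show "real n \<le> x" by (simp add: x)
  qed
qed

end

section \<open>Independence under injective reindexing\<close>

lemma (in prob_space) indep_sets_reindex:
  assumes inj: "inj_on f I" and indep: "indep_sets F (f ` I)"
  shows "indep_sets (\<lambda>i. F (f i)) I"
proof (rule indep_setsI)
  show "F (f i) \<subseteq> events" if "i \<in> I" for i
    using indep that by (auto simp: indep_sets_def)
  fix A J assume J: "J \<noteq> {}" "J \<subseteq> I" "finite J" and A: "\<forall>j\<in>J. A j \<in> F (f j)"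
  define A' where "A' = (\<lambda>k. A (the_inv_into J f k))"
  have "inj_on f J" using inj J by (auto intro: inj_on_subset)
  then have A': "A' (f j) = A j" if "j \<in> J" for j
    using that by (simp add: A'_def the_inv_into_f_f)
  have "prob (\<Inter>k\<in>f ` J. A' k) = (\<Prod>k\<in>f ` J. prob (A' k))"
    using J A A' by (intro indep_setsD[OF indep]) auto
  then show "prob (\<Inter>j\<in>J. A j) = (\<Prod>j\<in>J. prob (A j))"
    using \<open>inj_on f J\<close> by (simp add: prod.reindex A')
qed

lemma (in prob_space) indep_vars_reindex:
  assumes "inj_on f I" "indep_vars M' X (f ` I)"
  shows "indep_vars (\<lambda>i. M' (f i)) (\<lambda>i. X (f i)) I"
  using assms(2) indep_sets_reindex[OF assms(1),
      of "\<lambda>k. {X k -` A \<inter> space M |A. A \<in> sets (M' k)}"]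
  by (simp add: indep_vars_def2)

section \<open>Random sign matrices built from a sequence of independent fair signs\<close>

definition rademacher_seq :: "(nat \<Rightarrow> real) measure" where
  "rademacher_seq = PiM UNIV (\<lambda>_. measure_pmf (pmf_of_set {-1, 1}))"

text \<open>Agrees with the identity on -1 and 1. The sample space also contains sequences with
  other values, and \<open>sign_of\<close> makes the matrix entries signs at every sample point
  rather than almost surely, as \<open>sign_matrix\<close> demands.\<close>

definition sign_of :: "real \<Rightarrow> real" where
  "sign_of x = (if 0 \<le> x then 1 else -1)"

text \<open>Adding the two indices is injective on a single row or column, the only shapes used here.\<close>
definition sign_mat :: "nat \<Rightarrow> nat \<Rightarrow> (nat \<Rightarrow> real) \<Rightarrow> real mat" where
  "sign_mat m n \<omega> = mat m n (\<lambda>(i, j). sign_of (\<omega> (i + j)))"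

lemma prob_space_rademacher_seq: "prob_space rademacher_seq"
  unfolding rademacher_seq_def by (intro prob_space_PiM measure_pmf.prob_space_axioms)

lemma sign_matrix_sign_mat:
  "1 \<le> m \<Longrightarrow> 1 \<le> n \<Longrightarrow> sign_matrix rademacher_seq (sign_mat m n) m n"
  unfolding sign_matrix_def sign_matrix_axioms_def
  by (auto simp: prob_space_rademacher_seq sign_mat_def sign_of_def)

lemma distr_rademacher_seq:
  "distr rademacher_seq (measure_pmf (pmf_of_set {-1, 1})) (\<lambda>\<omega>. \<omega> k) = measure_pmf (pmf_of_set {-1, 1})"
  unfolding rademacher_seq_def
  by (rule distr_PiM_component) (auto intro: measure_pmf.prob_space_axioms)

lemma measurable_coordinate:
  "(\<lambda>\<omega>. \<omega> k) \<in> measurable rademacher_seq (measure_pmf (pmf_of_set {-1, 1}))"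
  unfolding rademacher_seq_def by (rule measurable_component_singleton) simp

lemma integral_sign_of:
  "integrable rademacher_seq (\<lambda>\<omega>. sign_of (\<omega> k))" "(\<integral>\<omega>. sign_of (\<omega> k) \<partial>rademacher_seq) = 0"
proof -
  interpret prob_space rademacher_seq by (rule prob_space_rademacher_seq)
  \<comment> \<open>Every set is measurable for \<open>measure_pmf\<close>, so any function of one
    coordinate is measurable.\<close>
  have "(\<lambda>\<omega>. sign_of (\<omega> k)) \<in> borel_measurable rademacher_seq"
    by (rule measurable_compose[OF measurable_coordinate]) simp
  then show "integrable rademacher_seq (\<lambda>\<omega>. sign_of (\<omega> k))"
    by (intro integrable_const_bound[where B = 1]) (auto simp: sign_of_def)
  have "(\<integral>\<omega>. sign_of (\<omega> k) \<partial>rademacher_seq) = (\<integral>x. sign_of x \<partial>measure_pmf (pmf_of_set {-1, 1}))"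
    by (subst distr_rademacher_seq[of k, symmetric], subst integral_distr)
      (use measurable_coordinate in simp_all)
  also have "\<dots> = 0"
    by (subst integral_pmf_of_set) (auto simp: sign_of_def)
  finally show "(\<integral>\<omega>. sign_of (\<omega> k) \<partial>rademacher_seq) = 0" .
qed

lemma indep_coordinates:
  "prob_space.indep_vars rademacher_seq (\<lambda>_. measure_pmf (pmf_of_set {-1, 1})) (\<lambda>k \<omega>. \<omega> k) UNIV"
proof -
  interpret prob_space rademacher_seq by (rule prob_space_rademacher_seq)
  \<comment> \<open>The identity map collects all coordinates, so their joint law is
    \<open>rademacher_seq\<close> itself, which is the product of their marginal laws. This is the
    criterion for independence.\<close>
  have "distr rademacher_seq (PiM UNIV (\<lambda>_. measure_pmf (pmf_of_set {-1, 1}))) (\<lambda>\<omega>. \<omega>) = rademacher_seq"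
    unfolding rademacher_seq_def by (rule distr_id)
  then show ?thesis
    by (subst indep_vars_iff_distr_eq_PiM)
      (simp_all only: distr_rademacher_seq measurable_coordinate restrict_UNIV UNIV_not_empty
        not_False_eq_True flip: rademacher_seq_def)
qed

text \<open>For one row or one column, distinct entries read distinct coordinates of the sequence,
  so independence passes from the coordinates to the entries by composing with
  \<open>sign_of\<close> and reindexing.\<close>

lemma indep_centered_sign_mat:
  assumes "m = 1 \<or> n = 1"
  shows "indep_centered_mat rademacher_seq m n (sign_mat m n)"
proof -
  interpret prob_space rademacher_seq by (rule prob_space_rademacher_seq)
  let ?f = "\<lambda>ij::nat \<times> nat. fst ij + snd ij"
  let ?I = "{..<m} \<times> {..<n}"
  have inj: "inj_on ?f ?I" using assms by (auto simp: inj_on_def)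
  have "indep_vars (\<lambda>_. borel) (\<lambda>k \<omega>. sign_of (\<omega> k)) UNIV"
    by (rule indep_vars_compose2[OF indep_coordinates]) simp
  then have "indep_vars (\<lambda>_. borel) (\<lambda>k \<omega>. sign_of (\<omega> k)) (?f ` ?I)"
    by (rule indep_vars_subset) simp
  then have "indep_vars (\<lambda>_. borel) (\<lambda>ij \<omega>. sign_of (\<omega> (?f ij))) ?I"
    by (rule indep_vars_reindex[OF inj])
  then have "indep_vars (\<lambda>_. borel) (\<lambda>ij \<omega>. sign_mat m n \<omega> $$ ij) ?I"
    by (rule indep_vars_cong[THEN iffD1, rotated 3]) (auto simp: sign_mat_def)
  then show ?thesis
    by (simp add: indep_centered_mat_def) (simp add: sign_mat_def integral_sign_of)
qed

(* The sequences live on one probability space with sample type nat => real, which is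
   large enough to carry any sequence of finite random real matrices up to joint law. *)
theorem mainTheorem10:
  shows "(\<exists>(M :: (nat \<Rightarrow> real) measure) (m :: nat \<Rightarrow> nat) (n :: nat \<Rightarrow> nat)
            (Z :: nat \<Rightarrow> (nat \<Rightarrow> real) \<Rightarrow> real mat) (c :: real) (C :: real).
            prob_space M \<and> 0 < c \<and> c \<le> C \<and>
            (\<forall>N\<ge>1. 1 \<le> m N \<and> 1 \<le> n N \<and> indep_centered_mat M (m N) (n N) (Z N) \<and>
               c * F_term M (Z N) \<le> E_inf_2 M (Z N) \<and>
               E_inf_2 M (Z N) \<le> C * F_term M (Z N)) \<and>
            filterlim (\<lambda>N. E_inf_2 M (Z N) / W_term M (n N) (Z N)) at_top sequentially)
       \<and> (\<exists>(M :: (nat \<Rightarrow> real) measure) (m :: nat \<Rightarrow> nat) (n :: nat \<Rightarrow> nat)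
            (Z :: nat \<Rightarrow> (nat \<Rightarrow> real) \<Rightarrow> real mat) (c :: real) (C :: real).
            prob_space M \<and> 0 < c \<and> c \<le> C \<and>
            (\<forall>N\<ge>1. 1 \<le> m N \<and> 1 \<le> n N \<and> indep_centered_mat M (m N) (n N) (Z N) \<and>
               c * W_term M (n N) (Z N) \<le> E_inf_2 M (Z N) \<and>
               E_inf_2 M (Z N) \<le> C * W_term M (n N) (Z N)) \<and>
            filterlim (\<lambda>N. E_inf_2 M (Z N) / F_term M (Z N)) at_top sequentially)"
proof -
  note prob_space_rademacher_seq [simp] indep_centered_sign_mat [simp]
  \<comment> \<open>Both ratios equal the square root of N: it is sqrt N / 1 for columns and N /
    sqrt N for rows.\<close>
  have sqrt_top: "filterlim (\<lambda>N. sqrt (real N)) at_top sequentially"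
    by (rule filterlim_compose[OF sqrt_at_top filterlim_real_sequentially])
  have col: "E_inf_2 rademacher_seq (sign_mat N 1) = sqrt N"
      "F_term rademacher_seq (sign_mat N 1) = sqrt N"
      "W_term rademacher_seq 1 (sign_mat N 1) = 1" if "1 \<le> N" for N
  proof -
    interpret sign_matrix rademacher_seq "sign_mat N 1" N 1
      using that by (intro sign_matrix_sign_mat) auto
    show "E_inf_2 rademacher_seq (sign_mat N 1) = sqrt N"
      "F_term rademacher_seq (sign_mat N 1) = sqrt N"
      "W_term rademacher_seq 1 (sign_mat N 1) = 1"
      using E_inf_2_col F_term_eq W_term_col by simp_all
  qed
  have row: "E_inf_2 rademacher_seq (sign_mat 1 N) = N"
      "F_term rademacher_seq (sign_mat 1 N) = sqrt N"
      "W_term rademacher_seq N (sign_mat 1 N) = N" if "1 \<le> N" for N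
  proof -
    interpret sign_matrix rademacher_seq "sign_mat 1 N" 1 N
      using that by (intro sign_matrix_sign_mat) auto
    show "E_inf_2 rademacher_seq (sign_mat 1 N) = N"
      "F_term rademacher_seq (sign_mat 1 N) = sqrt N"
      "W_term rademacher_seq N (sign_mat 1 N) = N"
      using E_inf_2_row F_term_eq W_term_row by simp_all
  qed
  have "filterlim (\<lambda>N. E_inf_2 rademacher_seq (sign_mat N 1) /
      W_term rademacher_seq 1 (sign_mat N 1)) at_top sequentially"
    \<comment> \<open>The closed forms in \<open>col\<close> are stated for N at least 1, which
      suffices for an eventual equality.\<close>
    by (rule filterlim_cong[THEN iffD1, OF refl refl _ sqrt_top])
      (auto intro!: eventually_sequentiallyI[of 1] simp: col[unfolded One_nat_def])
  moreover have "filterlim (\<lambda>N. E_inf_2 rademacher_seq (sign_mat 1 N) /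
      F_term rademacher_seq (sign_mat 1 N)) at_top sequentially"
    by (rule filterlim_cong[THEN iffD1, OF refl refl _ sqrt_top])
      (auto intro!: eventually_sequentiallyI[of 1] simp: row[unfolded One_nat_def] real_div_sqrt)
  ultimately show ?thesis
    \<comment> \<open>Both constants can be 1, since \<open>E_inf_2\<close> equals
      \<open>F_term\<close> exactly for columns and \<open>W_term\<close> exactly for rows.\<close>
    apply (intro conjI)
    subgoal
      by (rule exI[of _ rademacher_seq], rule exI[of _ "\<lambda>N. N"], rule exI[of _ "\<lambda>_. 1"],
          rule exI[of _ "\<lambda>N. sign_mat N 1"], rule exI[of _ 1], rule exI[of _ 1])
        (simp add: col del: One_nat_def)
    subgoal
      by (rule exI[of _ rademacher_seq], rule exI[of _ "\<lambda>_. 1"], rule exI[of _ "\<lambda>N. N"],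
          rule exI[of _ "sign_mat 1"], rule exI[of _ 1], rule exI[of _ 1])
        (simp add: row del: One_nat_def)
    done
qed

end
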